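(* Let $p$ be a prime and $k,r$ natural numbers, and let $R=\mathrm{GR}(p^k,r)$ be the Galois ring. Let $R\star R$ be the set $R\times R$ with group operation $(x,y)\star(x',y')=(x+x',\,y+y'+xx')$ (where $xx'$ is the ring product). Then $R\star R$ is isomorphic to $C_{p^k}^r\times C_{p^k}^r$ if $p\ge 3$, and to $C_{2^{k+1}}^r\times C_{2^{k-1}}^r$ if $p=2$.
   Context: The Galois ring $\mathrm{GR}(p^k,r)$ is the ring $\mathbb{Z}[x]/(p^k,f(x))$ where $f\in\mathbb{Z}[x]$ is a monic polynomial of degree $r$ whose reduction modulo $p$ is irreducible over $\mathbb{Z}/p\mathbb{Z}$; it is a finite commutative local ring of characteristic $p^k$, with additive group isomorphic to $C_{p^k}^r$, maximal ideal $pR$, and residue field of order $p^r$. $C_n$ denotes the cyclic group of order $n$ ($C_1$ trivial). *)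

theory Defs
  imports
    "HOL-Algebra.Algebra"
    "HOL-Algebra.Algebraic_Closure_Type"
    "HOL-Computational_Algebra.Computational_Algebra"
    "HOL-Number_Theory.Residues"
begin

abbreviation int_poly_ring :: "int poly ring" where
  "int_poly_ring \<equiv> ring_of_type_algebra"

definition reduce_poly :: "nat \<Rightarrow> int poly \<Rightarrow> nat \<Rightarrow> int" where
  "reduce_poly p f = (\<lambda>i. Polynomial.coeff f i mod int p)"

lemma reduce_poly_closed:
  assumes "Factorial_Ring.prime p"
  shows "reduce_poly p f \<in> carrier (UP (residue_ring (int p)))"
proof -
  have "\<exists>n. bound (0::int) n (reduce_poly p f)"
    by (rule exI[of _ "Polynomial.degree f"])
      (auto simp: bound_def reduce_poly_def Polynomial.coeff_eq_0)
  moreover have "reduce_poly p f i \<in> {0..int p - 1}" for i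
    using prime_gt_0_nat[OF assms] by (simp add: reduce_poly_def)
  ultimately show ?thesis
    by (auto simp: UP_def up_def residue_ring_def)
qed

text \<open>The quotient of the integer polynomials by the ideal generated by the constant
  \<open>p ^ k\<close> and \<open>f\<close>. This is a Galois ring of rank \<open>r\<close> if \<open>p\<close> is prime, \<open>k\<close> is positive and
  \<open>f\<close> is monic of degree \<open>r\<close> with irreducible reduction modulo \<open>p\<close>.\<close>
definition galois_ring :: "nat \<Rightarrow> nat \<Rightarrow> int poly \<Rightarrow> int poly set ring" where
  "galois_ring p k f =
     int_poly_ring Quot (Idl\<^bsub>int_poly_ring\<^esub> {[:int p ^ k:], f})"

lemma galois_ring_cring: "cring (galois_ring p k f)"
proof -
  interpret Z: cring int_poly_ring by (rule cring_from_type_algebra)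
  have "ideal (Idl\<^bsub>int_poly_ring\<^esub> {[:int p ^ k:], f}) int_poly_ring"
    by (rule Z.genideal_ideal) (simp add: ring_of_type_algebra_def)
  then show ?thesis
    unfolding galois_ring_def by (rule ideal.quotient_is_cring) (rule Z.is_cring)
qed

definition star_group :: "('a, 'm) ring_scheme \<Rightarrow> ('a \<times> 'a) monoid" where
  "star_group R =
     \<lparr>carrier = carrier R \<times> carrier R,
      monoid.mult = (\<lambda>(x, y) (x', y'). (x \<oplus>\<^bsub>R\<^esub> x', y \<oplus>\<^bsub>R\<^esub> y' \<oplus>\<^bsub>R\<^esub> x \<otimes>\<^bsub>R\<^esub> x')),
      one = (\<zero>\<^bsub>R\<^esub>, \<zero>\<^bsub>R\<^esub>)\<rparr>"

lemma star_group_comm_group: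
  fixes R (structure)
  assumes "cring R"
  shows "comm_group (star_group R)"
proof -
  interpret cring R by fact
  show ?thesis
  proof (rule comm_groupI)
    fix a assume "a \<in> carrier (star_group R)"
    then obtain x y where a: "a = (x, y)" "x \<in> carrier R" "y \<in> carrier R"
      by (auto simp: star_group_def)
    have "(\<ominus> y \<oplus> x \<otimes> x) \<oplus> y \<oplus> (\<ominus> x) \<otimes> x = \<zero>"
      using a by algebra
    then show "\<exists>b\<in>carrier (star_group R). b \<otimes>\<^bsub>star_group R\<^esub> a = \<one>\<^bsub>star_group R\<^esub>"
      using a by (intro bexI[of _ "(\<ominus> x, \<ominus> y \<oplus> x \<otimes> x)"]) (auto simp: star_group_def l_neg)
  qed (auto simp: star_group_def a_ac m_ac l_distr r_distr)
qed

abbreviation cyclic_power :: "nat \<Rightarrow> nat \<Rightarrow> (nat \<Rightarrow> int) monoid" where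
  "cyclic_power n r \<equiv> product_group {..<r} (\<lambda>_. integer_mod_group n)"

end

theory Submission
  imports Defs "HOL-Library.Z2" "HOL-Library.Product_Plus"
begin

text \<open>For odd \<open>p\<close> the map \<open>(x, y) \<mapsto> (x, y - x\<^sup>2/2)\<close> straightens \<open>\<star>\<close> to componentwise addition.
  For \<open>p = 2\<close> the map \<open>(x, y) \<mapsto> (x, x\<^sup>2 - 2 y)\<close>, with the second component taken modulo
  \<open>2\<^sup>k\<^sup>+\<^sup>1\<close>, is an injective homomorphism into an additive group, and its image consists of
  the pairs \<open>(x, t)\<close> with \<open>t \<equiv> x\<^sup>2\<close> modulo \<open>2\<close>. As the Frobenius map of the residue field is
  bijective, the squares \<open>X\<^sup>2\<^sup>i\<close> (\<open>i < r\<close>) form a basis modulo \<open>2\<^sup>k\<^sup>+\<^sup>1\<close>. In the coordinates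
  \<open>x = \<Sum> x\<^sub>i X\<^sup>i\<close>, \<open>t = \<Sum> t\<^sub>i X\<^sup>2\<^sup>i\<close> the condition is \<open>t\<^sub>i \<equiv> x\<^sub>i\<close> modulo \<open>2\<close>, solved by
  \<open>x\<^sub>i = a\<^sub>i + 2 b\<^sub>i\<close>, \<open>t\<^sub>i = a\<^sub>i + 4 b\<^sub>i\<close> with \<open>a\<^sub>i\<close> modulo \<open>2\<^sup>k\<^sup>+\<^sup>1\<close> and \<open>b\<^sub>i\<close> modulo
  \<open>2\<^sup>k\<^sup>-\<^sup>1\<close>.\<close>

section \<open>Quotients of a common group, and coefficients modulo \<open>n\<close>\<close>

text \<open>By the first isomorphism theorem both groups are the quotient of \<open>A\<close> by the
  same kernel, so no map between \<open>G\<close> and \<open>H\<close> has to be written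
  down.\<close>

lemma iso_of_same_kernel:
  assumes A: "group A" and G: "group G" and H: "group H"
    and g: "g \<in> hom A G" "g ` carrier A = carrier G"
    and h: "h \<in> hom A H" "h ` carrier A = carrier H"
    and kernels: "\<And>x. x \<in> carrier A \<Longrightarrow> g x = \<one>\<^bsub>G\<^esub> \<longleftrightarrow> h x = \<one>\<^bsub>H\<^esub>"
  shows "G \<cong> H"
proof -
  interpret g: group_hom A G g
    using A G g(1) by (simp add: group_hom_def group_hom_axioms_def)
  interpret h: group_hom A H h
    using A H h(1) by (simp add: group_hom_def group_hom_axioms_def)
  have same: "kernel A G g = kernel A H h"
    using kernels by (auto simp: kernel_def)
  have "A Mod kernel A G g \<cong> G" by (rule g.FactGroup_iso[OF g(2)])
  moreover have "A Mod kernel A G g \<cong> H" using h.FactGroup_iso[OF h(2)] same by simp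
  moreover have "group (A Mod kernel A G g)"
    by (rule normal.factorgroup_is_group[OF g.normal_kernel])
  ultimately show ?thesis
    using group.iso_sym iso_trans by blast
qed

text \<open>A bound on coefficients instead of \<open>degree\<close> gives a subgroup for every
  \<open>r\<close>, also for \<open>r = 0\<close>, where only \<open>0\<close> remains. For
  \<open>f\<close> monic of degree \<open>r\<close> these are the possible remainders modulo
  \<open>f\<close>.\<close>

definition low_polys :: "nat \<Rightarrow> int poly set" where
  "low_polys r = {a. \<forall>i\<ge>r. Polynomial.coeff a i = 0}"

lemma low_polys_closed [intro]:
  assumes "a \<in> low_polys r" "b \<in> low_polys r"
  shows "a + b \<in> low_polys r" "a - b \<in> low_polys r"
  using assms by (auto simp: low_polys_def)

lemma low_polys_smult: "a \<in> low_polys r \<Longrightarrow> Polynomial.smult c a \<in> low_polys r"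
  by (simp add: low_polys_def)

lemma zero_low_polys [simp]: "0 \<in> low_polys r"
  by (simp add: low_polys_def)

text \<open>A free abelian group of rank \<open>2 r\<close> that is mapped onto both sides of the
  claimed isomorphisms. On integer polynomials the moduli enter only through kernels.\<close>

definition low_poly_pairs :: "nat \<Rightarrow> (int poly \<times> int poly) monoid" where
  "low_poly_pairs r = \<lparr>carrier = low_polys r \<times> low_polys r, monoid.mult = (+), one = 0\<rparr>"

lemma group_low_poly_pairs: "group (low_poly_pairs r)"
proof (rule groupI)
  fix x assume "x \<in> carrier (low_poly_pairs r)"
  then show "\<exists>y\<in>carrier (low_poly_pairs r). y \<otimes>\<^bsub>low_poly_pairs r\<^esub> x = \<one>\<^bsub>low_poly_pairs r\<^esub>"
    by (intro bexI[of _ "- x"]) (auto simp: low_poly_pairs_def low_polys_def)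
qed (auto simp: low_poly_pairs_def add.assoc zero_prod_def)

definition coeffs_mod :: "nat \<Rightarrow> nat \<Rightarrow> int poly \<Rightarrow> nat \<Rightarrow> int" where
  "coeffs_mod n r a = (\<lambda>i\<in>{..<r}. Polynomial.coeff a i mod int n)"

lemma coeffs_mod_add:
  "coeffs_mod n r (a + b) = coeffs_mod n r a \<otimes>\<^bsub>cyclic_power n r\<^esub> coeffs_mod n r b"
  by (auto simp: coeffs_mod_def mod_simps)

lemma coeffs_mod_image:
  assumes "n > 0"
  shows "coeffs_mod n r ` low_polys r = carrier (cyclic_power n r)"
proof
  show "coeffs_mod n r ` low_polys r \<subseteq> carrier (cyclic_power n r)"
    using assms by (auto simp: coeffs_mod_def carrier_integer_mod_group)
  show "carrier (cyclic_power n r) \<subseteq> coeffs_mod n r ` low_polys r"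
  proof
    fix c assume c: "c \<in> carrier (cyclic_power n r)"
    define a where "a = Poly (map c [0..<r])"
    have coeff_a: "Polynomial.coeff a i = (if i < r then c i else 0)" for i
      by (simp add: a_def nth_default_def)
    have "coeffs_mod n r a = c"
      using c assms by (intro extensionalityI[of _ "{..<r}"])
        (auto simp: coeffs_mod_def coeff_a carrier_integer_mod_group PiE_iff)
    moreover have "a \<in> low_polys r" by (auto simp: low_polys_def coeff_a)
    ultimately show "c \<in> coeffs_mod n r ` low_polys r" by blast
  qed
qed

lemma coeffs_mod_eq_one_iff:
  assumes "a \<in> low_polys r"
  shows "coeffs_mod n r a = \<one>\<^bsub>cyclic_power n r\<^esub> \<longleftrightarrow> [:int n:] dvd a"
proof -
  have "coeffs_mod n r a = \<one>\<^bsub>cyclic_power n r\<^esub> \<longleftrightarrow>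
      (\<forall>i<r. int n dvd Polynomial.coeff a i)"
    by (auto simp: coeffs_mod_def fun_eq_iff restrict_def dvd_eq_mod_eq_0)
  also have "\<dots> \<longleftrightarrow> (\<forall>i. int n dvd Polynomial.coeff a i)"
    using assms by (auto simp: low_polys_def) (metis dvd_0_right not_le)
  finally show ?thesis by (simp add: const_poly_dvd_iff)
qed

lemma image_map_prod_Times: "map_prod f g ` (A \<times> B) = f ` A \<times> g ` B"
  by auto

text \<open>The criterion for both cases of the theorem: coefficientwise reduction modulo
  \<open>m\<close> and \<open>n\<close> is onto and has the kernel prescribed for \<open>g\<close>,
  so the two images are isomorphic.\<close>

lemma iso_cyclic_powers:
  assumes "m > 0" "n > 0" and G: "group G"
    and g: "g \<in> hom (low_poly_pairs r) G" "carrier G \<subseteq> g ` (low_polys r \<times> low_polys r)"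
    and ker: "\<And>a b. \<lbrakk>a \<in> low_polys r; b \<in> low_polys r\<rbrakk> \<Longrightarrow>
      g (a, b) = \<one>\<^bsub>G\<^esub> \<longleftrightarrow> [:int m:] dvd a \<and> [:int n:] dvd b"
  shows "G \<cong> cyclic_power m r \<times>\<times> cyclic_power n r"
proof (rule iso_of_same_kernel[OF group_low_poly_pairs G _ g(1)])
  let ?h = "map_prod (coeffs_mod m r) (coeffs_mod n r)"
  show "group (cyclic_power m r \<times>\<times> cyclic_power n r)"
    by (intro DirProd_group product_group group_integer_mod_group)
  show "g ` carrier (low_poly_pairs r) = carrier G"
    using g by (auto simp: low_poly_pairs_def hom_def Pi_def)
  show im: "?h ` carrier (low_poly_pairs r) = carrier (cyclic_power m r \<times>\<times> cyclic_power n r)"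
    using coeffs_mod_image[of m r] coeffs_mod_image[of n r] assms(1,2)
    by (simp add: low_poly_pairs_def image_map_prod_Times del: carrier_product_group)
  show "?h \<in> hom (low_poly_pairs r) (cyclic_power m r \<times>\<times> cyclic_power n r)"
  proof (rule homI)
    fix x y
    assume "x \<in> carrier (low_poly_pairs r)"
    then show "?h x \<in> carrier (cyclic_power m r \<times>\<times> cyclic_power n r)"
      using im by blast
    show "?h (x \<otimes>\<^bsub>low_poly_pairs r\<^esub> y) =
        ?h x \<otimes>\<^bsub>cyclic_power m r \<times>\<times> cyclic_power n r\<^esub> ?h y"
      by (cases x; cases y)
        (simp add: low_poly_pairs_def coeffs_mod_add del: mult_product_group)
  qed
  show "g x = \<one>\<^bsub>G\<^esub> \<longleftrightarrow> ?h x = \<one>\<^bsub>cyclic_power m r \<times>\<times> cyclic_power n r\<^esub>"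
    if "x \<in> carrier (low_poly_pairs r)" for x
    using that ker coeffs_mod_eq_one_iff
    by (cases x) (simp add: low_poly_pairs_def del: one_product_group)
qed

section \<open>The ideal generated by \<open>n\<close> and \<open>f\<close>, and residue classes of
  the Galois ring\<close>

text \<open>The modulus is an arbitrary integer because the case \<open>p = 2\<close> also works
  modulo \<open>2\<close> and modulo \<open>2 ^ (k + 1)\<close>.\<close>

definition galois_ideal :: "int \<Rightarrow> int poly \<Rightarrow> int poly set" where
  "galois_ideal n f = {[:n:] * u + f * v | u v. True}"

definition galois_class :: "nat \<Rightarrow> nat \<Rightarrow> int poly \<Rightarrow> int poly \<Rightarrow> int poly set" where
  "galois_class p k f a =
     Idl\<^bsub>int_poly_ring\<^esub> {[:int p ^ k:], f} +>\<^bsub>int_poly_ring\<^esub> a"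

lemma int_poly_ring_simps:
  "carrier int_poly_ring = UNIV" "a \<otimes>\<^bsub>int_poly_ring\<^esub> b = a * b" "a \<oplus>\<^bsub>int_poly_ring\<^esub> b = a + b"
  "\<zero>\<^bsub>int_poly_ring\<^esub> = 0" "\<one>\<^bsub>int_poly_ring\<^esub> = 1"
  by (simp_all add: ring_of_type_algebra_def)

lemma ideal_galois_ideal: "ideal (galois_ideal n f) int_poly_ring"
proof -
  interpret Z: cring int_poly_ring by (rule cring_from_type_algebra)
  have neg: "\<ominus>\<^bsub>int_poly_ring\<^esub> a = - a" for a :: "int poly"
    by (rule Z.sum_zero_eq_neg[symmetric]) (auto simp: int_poly_ring_simps)
  have mult: "x * a \<in> galois_ideal n f" if a: "a \<in> galois_ideal n f" for a x
  proof -
    obtain u v where "a = [:n:] * u + f * v" using a unfolding galois_ideal_def by blast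
    then have "x * a = [:n:] * (x * u) + f * (x * v)" by (simp add: algebra_simps)
    then show ?thesis unfolding galois_ideal_def by blast
  qed
  have add: "a + b \<in> galois_ideal n f" if ab: "a \<in> galois_ideal n f" "b \<in> galois_ideal n f" for a b
  proof -
    obtain u v u' v' where "a = [:n:] * u + f * v" "b = [:n:] * u' + f * v'"
      using ab unfolding galois_ideal_def by blast
    then have "a + b = [:n:] * (u + u') + f * (v + v')" by (simp only: algebra_simps)
    then show ?thesis unfolding galois_ideal_def by blast
  qed
  have zero: "0 \<in> galois_ideal n f"
    unfolding galois_ideal_def by (rule CollectI, rule exI[of _ 0], rule exI[of _ 0]) simp
  have "subgroup (galois_ideal n f) (add_monoid int_poly_ring)"
  proof (rule group.subgroupI)
    show "Group.group (add_monoid int_poly_ring)" by (rule Z.a_group)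
    show "inv\<^bsub>add_monoid int_poly_ring\<^esub> a \<in> galois_ideal n f" if "a \<in> galois_ideal n f" for a
      using mult[OF that, of "- 1"] neg[of a] by (simp add: a_inv_def)
  qed (use zero add in \<open>auto simp: int_poly_ring_simps\<close>)
  then show ?thesis
    using mult by (intro idealI Z.ring_axioms) (auto simp: int_poly_ring_simps mult.commute)
qed

text \<open>The explicit combinations form an ideal containing both generators, and every ideal
  containing the generators contains them. Membership thereby becomes a matter of exhibiting two
  cofactors.\<close>

lemma genideal_eq_galois_ideal: "Idl\<^bsub>int_poly_ring\<^esub> {[:n:], f} = galois_ideal n f"
proof
  interpret Z: cring int_poly_ring by (rule cring_from_type_algebra)
  have gens: "[:n:] \<in> galois_ideal n f" "f \<in> galois_ideal n f"
    unfolding galois_ideal_def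
    by (rule CollectI, rule exI[of _ 1], rule exI[of _ 0], simp)
       (rule CollectI, rule exI[of _ 0], rule exI[of _ 1], simp)
  then show "Idl\<^bsub>int_poly_ring\<^esub> {[:n:], f} \<subseteq> galois_ideal n f"
    by (intro Z.genideal_minimal ideal_galois_ideal) auto
  have I: "ideal (Idl\<^bsub>int_poly_ring\<^esub> {[:n:], f}) int_poly_ring"
    by (rule Z.genideal_ideal) (simp add: int_poly_ring_simps)
  interpret I: ideal "Idl\<^bsub>int_poly_ring\<^esub> {[:n:], f}" int_poly_ring by (rule I)
  have "{[:n:], f} \<subseteq> Idl\<^bsub>int_poly_ring\<^esub> {[:n:], f}"
    by (rule Z.genideal_self) (simp add: int_poly_ring_simps)
  then have "[:n:] * u + f * v \<in> Idl\<^bsub>int_poly_ring\<^esub> {[:n:], f}" for u v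
    using I.a_closed[OF I.I_r_closed[of "[:n:]" u] I.I_r_closed[of f v]]
    by (simp only: int_poly_ring_simps insert_subset UNIV_I)
  then show "galois_ideal n f \<subseteq> Idl\<^bsub>int_poly_ring\<^esub> {[:n:], f}"
    unfolding galois_ideal_def by blast
qed

lemma galois_class_ring_hom: "galois_class p k f \<in> ring_hom int_poly_ring (galois_ring p k f)"
proof -
  have "galois_class p k f = a_r_coset int_poly_ring (Idl\<^bsub>int_poly_ring\<^esub> {[:int p ^ k:], f})"
    by (simp add: galois_class_def fun_eq_iff)
  then show ?thesis
    using ideal.rcos_ring_hom[OF ideal_galois_ideal[of "int p ^ k" f]]
    by (simp add: galois_ring_def genideal_eq_galois_ideal)
qed

lemma galois_class_simps:
  "galois_class p k f a \<in> carrier (galois_ring p k f)"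
  "galois_class p k f (a + b) = galois_class p k f a \<oplus>\<^bsub>galois_ring p k f\<^esub> galois_class p k f b"
  "galois_class p k f (a * b) = galois_class p k f a \<otimes>\<^bsub>galois_ring p k f\<^esub> galois_class p k f b"
  using ring_hom_closed[OF galois_class_ring_hom, of a p k f]
    ring_hom_add[OF galois_class_ring_hom, of a b p k f]
    ring_hom_mult[OF galois_class_ring_hom, of a b p k f]
  by (simp_all only: int_poly_ring_simps UNIV_I)

lemma galois_class_surj:
  assumes "Z \<in> carrier (galois_ring p k f)"
  obtains a where "Z = galois_class p k f a"
  using assms that
  by (auto simp: galois_ring_def FactRing_def A_RCOSETS_def' galois_class_def int_poly_ring_simps)

lemma galois_class_eq_iff:
  "galois_class p k f a = galois_class p k f b \<longleftrightarrow> a - b \<in> galois_ideal (int p ^ k) f"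
proof -
  let ?I = "galois_ideal (int p ^ k) f"
  interpret Z: cring int_poly_ring by (rule cring_from_type_algebra)
  interpret I: ideal ?I int_poly_ring by (rule ideal_galois_ideal)
  have "galois_class p k f a = galois_class p k f b \<longleftrightarrow> a \<in> ?I +>\<^bsub>int_poly_ring\<^esub> b"
    unfolding galois_class_def genideal_eq_galois_ideal
    using I.a_repr_independence'[of a b] I.a_rcos_self[of a] by (auto simp: int_poly_ring_simps)
  also have "\<dots> \<longleftrightarrow> a - b \<in> ?I"
    by (auto simp: a_r_coset_def' int_poly_ring_simps) (metis diff_add_cancel)
  finally show ?thesis .
qed

lemma galois_class_eq_zero_iff:
  "galois_class p k f a = \<zero>\<^bsub>galois_ring p k f\<^esub> \<longleftrightarrow> a \<in> galois_ideal (int p ^ k) f"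
proof -
  interpret R: cring "galois_ring p k f" by (rule galois_ring_cring)
  have "galois_class p k f 0 = \<zero>\<^bsub>galois_ring p k f\<^esub>"
    using ring_hom_zero[OF galois_class_ring_hom ring_from_type_algebra R.ring_axioms]
    by (simp add: int_poly_ring_simps)
  then show ?thesis using galois_class_eq_iff[of p k f a 0] by simp
qed

section \<open>Division by a monic polynomial\<close>

text \<open>Pseudo-division scales the dividend by a power of the leading coefficient, which is
  \<open>1\<close> here, so it is genuine division over the integers.\<close>

lemma monic_division:
  fixes a f :: "int poly"
  assumes "Polynomial.lead_coeff f = 1"
  obtains q c where "a = f * q + c" "c \<in> low_polys (Polynomial.degree f)"
proof -
  obtain q c where qc: "pseudo_divmod a f = (q, c)" by fastforce
  have "f \<noteq> 0" using assms by auto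
  from pseudo_divmod[OF this qc] assms
  have "a = f * q + c" "c = 0 \<or> Polynomial.degree c < Polynomial.degree f" by simp_all
  moreover have "c \<in> low_polys (Polynomial.degree f)"
    using calculation(2) by (auto simp: low_polys_def intro: Polynomial.coeff_eq_0)
  ultimately show thesis using that by blast
qed

text \<open>The leading coefficient of \<open>v\<close> reappears in \<open>f * v\<close> at an
  index of at least \<open>degree f\<close>. This yields uniqueness of remainders.\<close>

lemma monic_mult_low:
  fixes f v :: "int poly"
  assumes "Polynomial.lead_coeff f = 1" "f * v \<in> low_polys (Polynomial.degree f)"
  shows "v = 0"
proof -
  have "Polynomial.coeff (f * v) (Polynomial.degree f + Polynomial.degree v) = 0"
    using assms(2) by (simp add: low_polys_def)
  then show ?thesis using assms(1) by (simp add: coeff_mult_degree_sum)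
qed

lemma galois_idealI: "z = [:n:] * u + f * v \<Longrightarrow> z \<in> galois_ideal n f"
  unfolding galois_ideal_def by blast

lemma galois_idealE:
  assumes "z \<in> galois_ideal n f"
  obtains u v where "z = [:n:] * u + f * v"
  using assms unfolding galois_ideal_def by blast

text \<open>Replacing the cofactor \<open>u\<close> by its remainder \<open>c\<close> modulo
  \<open>f\<close> makes \<open>a - n c\<close> a multiple of \<open>f\<close> of too low a degree,
  hence zero. All kernel computations rest on this.\<close>

lemma galois_ideal_low_dvd:
  assumes f: "Polynomial.lead_coeff f = 1"
    and a: "a \<in> low_polys (Polynomial.degree f)" "a \<in> galois_ideal n f"
  shows "[:n:] dvd a"
proof -
  obtain u v where uv: "a = [:n:] * u + f * v" using a(2) by (rule galois_idealE)
  obtain q c where qc: "u = f * q + c" "c \<in> low_polys (Polynomial.degree f)"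
    by (rule monic_division[OF f])
  have "a - [:n:] * c = f * (v + [:n:] * q)"
    unfolding uv qc(1) by (simp only: algebra_simps)
  moreover have "a - [:n:] * c \<in> low_polys (Polynomial.degree f)"
    using low_polys_closed(2)[OF a(1) low_polys_smult[OF qc(2)]] by simp
  ultimately have "v + [:n:] * q = 0" using monic_mult_low[OF f] by metis
  then have "a = [:n:] * c"
    using \<open>a - [:n:] * c = f * (v + [:n:] * q)\<close> by simp
  then show ?thesis by (rule dvdI)
qed

lemma galois_ideal_closed:
  assumes "a \<in> galois_ideal n f"
  shows "b \<in> galois_ideal n f \<Longrightarrow> a + b \<in> galois_ideal n f"
    "b \<in> galois_ideal n f \<Longrightarrow> a - b \<in> galois_ideal n f"
    "x * a \<in> galois_ideal n f"
proof -
  obtain u v where a: "a = [:n:] * u + f * v" using assms by (rule galois_idealE)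
  have "x * a = [:n:] * (x * u) + f * (x * v)" unfolding a by (simp only: algebra_simps)
  then show "x * a \<in> galois_ideal n f" by (rule galois_idealI)
  assume "b \<in> galois_ideal n f"
  then obtain u' v' where b: "b = [:n:] * u' + f * v'" by (rule galois_idealE)
  have "a + b = [:n:] * (u + u') + f * (v + v')" unfolding a b by (simp only: algebra_simps)
  then show "a + b \<in> galois_ideal n f" by (rule galois_idealI)
  have "a - b = [:n:] * (u - u') + f * (v - v')" unfolding a b by (simp only: algebra_simps)
  then show "a - b \<in> galois_ideal n f" by (rule galois_idealI)
qed

lemma dvd_imp_galois_ideal: "[:n:] dvd a \<Longrightarrow> a \<in> galois_ideal n f"
proof (elim dvdE)
  show "a \<in> galois_ideal n f" if "a = [:n:] * u" for u
    using that by (intro galois_idealI[where v = 0 and u = u]) simp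
qed

text \<open>A prime integer stays prime as a constant polynomial, and it cannot divide
  \<open>f\<close>, whose leading coefficient is \<open>1\<close>.\<close>

lemma prime_dvd_monic_mult:
  fixes f v :: "int poly"
  assumes "Polynomial.lead_coeff f = 1" "Factorial_Ring.prime p" "[:p:] dvd f * v"
  shows "[:p:] dvd v"
proof -
  have "Factorial_Ring.prime_elem [:p:]"
    using assms(2) by (metis prime_elem_const_poly_iff prime_imp_prime_elem)
  moreover have "\<not> [:p:] dvd f"
    using assms(1,2) const_poly_dvd_iff[of p f] not_prime_unit by metis
  ultimately show ?thesis using assms(3) prime_elem_dvd_mult_iff by blast
qed

section \<open>Reduction modulo 2 and irreducibility\<close>

text \<open>With coefficients in the field type \<open>bit\<close>, the type class results on
  polynomials over fields apply, notably that irreducible polynomials are prime.\<close>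

definition poly_mod2 :: "int poly \<Rightarrow> bit poly" where
  "poly_mod2 = map_poly of_int"

declare add_bit_eq_xor [simp del] mult_bit_eq_and [simp del]

lemma coeff_poly_mod2: "Polynomial.coeff (poly_mod2 a) i = of_int (Polynomial.coeff a i)"
  by (simp add: poly_mod2_def coeff_map_poly)

lemma of_int_bit_eq_0_iff: "(of_int c :: bit) = 0 \<longleftrightarrow> 2 dvd c"
  by (metis Z2.bit_eq_iff even_of_int_iff even_zero)

lemma poly_mod2_hom:
  "poly_mod2 (a + b) = poly_mod2 a + poly_mod2 b"
  "poly_mod2 (a - b) = poly_mod2 a - poly_mod2 b"
  "poly_mod2 (a * b) = poly_mod2 a * poly_mod2 b"
  by (rule poly_eqI; simp only: coeff_poly_mod2 coeff_add coeff_diff of_int_add of_int_diff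
      coeff_mult of_int_sum of_int_mult)+

lemma poly_mod2_eq_0_iff: "poly_mod2 a = 0 \<longleftrightarrow> [:2:] dvd a"
  by (simp add: poly_eq_iff coeff_poly_mod2 of_int_bit_eq_0_iff const_poly_dvd_iff
      del: bit_not_zero_iff)

lemma poly_mod2_eq_iff: "poly_mod2 a = poly_mod2 b \<longleftrightarrow> [:2:] dvd a - b"
  by (metis poly_mod2_eq_0_iff poly_mod2_hom(2) right_minus_eq)

text \<open>The lift with coefficients \<open>0\<close> and \<open>1\<close> later supplies a finite
  system of representatives.\<close>

lemma surj_poly_mod2:
  obtains a where "G = poly_mod2 a" "\<And>i. Polynomial.coeff a i \<in> {0, 1}"
proof -
  define a where "a = map_poly (\<lambda>b::bit. if b = 0 then 0 else 1 :: int) G"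
  have "Polynomial.coeff a i = (if Polynomial.coeff G i = 0 then 0 else 1)" for i
    by (simp add: a_def coeff_map_poly)
  then have "\<And>i. Polynomial.coeff a i \<in> {0, 1}" "G = poly_mod2 a"
    by (auto simp: poly_eq_iff coeff_poly_mod2)
  then show thesis using that by blast
qed

lemma reduce_poly_2_eq_iff: "reduce_poly 2 a = reduce_poly 2 b \<longleftrightarrow> poly_mod2 a = poly_mod2 b"
  unfolding poly_mod2_eq_iff const_poly_dvd_iff reduce_poly_def fun_eq_iff
  by (simp add: mod_eq_dvd_iff)

lemma reduce_poly_mult:
  assumes "Factorial_Ring.prime p"
  shows "reduce_poly p a \<otimes>\<^bsub>UP (residue_ring (int p))\<^esub> reduce_poly p b = reduce_poly p (a * b)"
proof -
  interpret residues_prime p "residue_ring (int p)"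
    using assms by unfold_locales simp_all
  have "reduce_poly p c \<in> up (residue_ring (int p))" for c
    using reduce_poly_closed[OF assms] by (simp add: UP_def)
  then show ?thesis
    by (simp add: UP_def reduce_poly_def fun_eq_iff coeff_mult mult_cong sum_cong)
qed

lemma reduce_poly_surj:
  assumes "Factorial_Ring.prime p" "P \<in> carrier (UP (residue_ring (int p)))"
  obtains a where "P = reduce_poly p a"
proof -
  have P: "\<And>i. P i \<in> {0..int p - 1}" "\<exists>n. bound 0 n P"
    using assms(2) by (auto simp: UP_def up_def residue_ring_def)
  then have "MOST i. P i = 0"
    unfolding MOST_nat by (auto simp: bound_def)
  then have "P = reduce_poly p (Abs_poly P)"
    using P(1) by (auto simp: reduce_poly_def Abs_poly_inverse fun_eq_iff)
  then show thesis using that by blast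
qed

lemma reduce_poly_1:
  assumes "Factorial_Ring.prime p"
  shows "\<one>\<^bsub>UP (residue_ring (int p))\<^esub> = reduce_poly p 1"
  using prime_gt_1_nat[OF assms] by (auto simp: UP_def residue_ring_def reduce_poly_def fun_eq_iff)

text \<open>Both reductions are multiplicative, onto, and identify the same integer polynomials, so
  divisibility agrees in the two rings. Units are the divisors of one, and irreducibility is
  expressed through units and divisibility.\<close>

lemma irreducible_poly_mod2:
  assumes "ring_irreducible\<^bsub>UP (residue_ring 2)\<^esub> (reduce_poly 2 f)"
  shows "Factorial_Ring.irreducible (poly_mod2 f)"
proof -
  let ?U = "UP (residue_ring 2)"
  have two: "Factorial_Ring.prime (2::nat)" by simp
  note surj = reduce_poly_surj[OF two, simplified]
  note mult = reduce_poly_mult[OF two, simplified]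
  note one = reduce_poly_1[OF two, simplified]
  note closed = reduce_poly_closed[OF two, simplified]
  have divides_iff: "reduce_poly 2 a divides\<^bsub>?U\<^esub> reduce_poly 2 b \<longleftrightarrow> poly_mod2 a dvd poly_mod2 b"
    for a b
  proof
    assume "reduce_poly 2 a divides\<^bsub>?U\<^esub> reduce_poly 2 b"
    then obtain c where "c \<in> carrier ?U" "reduce_poly 2 b = reduce_poly 2 a \<otimes>\<^bsub>?U\<^esub> c"
      by (auto simp: factor_def)
    then show "poly_mod2 a dvd poly_mod2 b"
      by (metis surj mult reduce_poly_2_eq_iff poly_mod2_hom(3) dvd_triv_left)
  next
    assume "poly_mod2 a dvd poly_mod2 b"
    then obtain c where "poly_mod2 b = poly_mod2 (a * c)"
      by (metis dvdE surj_poly_mod2 poly_mod2_hom(3))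
    then have "reduce_poly 2 b = reduce_poly 2 a \<otimes>\<^bsub>?U\<^esub> reduce_poly 2 c"
      by (simp add: mult reduce_poly_2_eq_iff)
    then show "reduce_poly 2 a divides\<^bsub>?U\<^esub> reduce_poly 2 b"
      using closed by (auto simp: factor_def)
  qed
  have mod2_1: "poly_mod2 1 = 1" by (simp add: poly_mod2_def map_poly_1)
  have unit_iff: "reduce_poly 2 a \<in> Units ?U \<longleftrightarrow> poly_mod2 a dvd 1" for a
  proof -
    have "reduce_poly 2 a \<in> Units ?U \<longleftrightarrow> reduce_poly 2 a divides\<^bsub>?U\<^esub> reduce_poly 2 1"
    proof -
      interpret cring "residue_ring 2"
        by (rule residues.cring) (simp add: residues_def)
      interpret UP_cring "residue_ring 2" ?U
        by unfold_locales simp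
      show ?thesis using closed[of a] P.Unit_eq_dividesone[of "reduce_poly 2 a"] one by simp
    qed
    then show ?thesis using divides_iff mod2_1 by metis
  qed
  have irr: "reduce_poly 2 f \<noteq> \<zero>\<^bsub>?U\<^esub>" "reduce_poly 2 f \<notin> Units ?U"
    "\<And>b. \<lbrakk>b \<in> carrier ?U; properfactor ?U b (reduce_poly 2 f)\<rbrakk> \<Longrightarrow> b \<in> Units ?U"
    using assms by (auto simp: ring_irreducible_def Divisibility.irreducible_def)
  show ?thesis
  proof (rule Factorial_Ring.irreducibleI)
    have "\<zero>\<^bsub>?U\<^esub> = reduce_poly 2 0"
      by (simp add: UP_def reduce_poly_def residue_ring_def)
    then show "poly_mod2 f \<noteq> 0"
      using irr(1) reduce_poly_2_eq_iff[of f 0] by (simp add: poly_mod2_def)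
    then have nz: "poly_mod2 f \<noteq> 0" .
    show "\<not> poly_mod2 f dvd 1" using irr(2) unit_iff by simp
    fix g h assume gh: "poly_mod2 f = g * h"
    obtain a where a: "g = poly_mod2 a" by (rule surj_poly_mod2)
    show "g dvd 1 \<or> h dvd 1"
    \<comment> \<open>If \<open>f\<close> divides \<open>g\<close> modulo \<open>2\<close>,
      cancelling \<open>g\<close> makes \<open>h\<close> a unit; otherwise \<open>g\<close> is a
      proper factor and so a unit by assumption.\<close>
    proof (cases "poly_mod2 f dvd g")
      case True
      then have "g * h dvd g * 1" "g \<noteq> 0" using gh nz by auto
      then show ?thesis by (metis dvd_mult_cancel_left)
    next
      case False
      then have "properfactor ?U (reduce_poly 2 a) (reduce_poly 2 f)"
        using gh a by (simp add: properfactor_def divides_iff)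
      then show ?thesis using irr(3) closed unit_iff a by blast
    qed
  qed
qed

section \<open>The map sending a(X) to a(X^2), modulo \<open>f\<close> and powers of 2\<close>

text \<open>The additive lift \<open>a(X) \<mapsto> a(X\<^sup>2)\<close> of the Frobenius map modulo \<open>2\<close>.\<close>
definition expand_sq :: "int poly \<Rightarrow> int poly" where
  "expand_sq a = pcompose a [:0, 0, 1:]"

lemma expand_sq_add: "expand_sq (a + b) = expand_sq a + expand_sq b"
  and expand_sq_diff: "expand_sq (a - b) = expand_sq a - expand_sq b"
  and expand_sq_smult: "expand_sq ([:c:] * a) = [:c:] * expand_sq a"
  by (simp_all add: expand_sq_def pcompose_add pcompose_diff pcompose_smult)

text \<open>Induction over the coefficients: the cross term of \<open>(c + X a)\<^sup>2\<close> is
  even, and \<open>c\<^sup>2\<close> is congruent to \<open>c\<close> modulo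
  \<open>2\<close>.\<close>

lemma square_cong_expand_sq: "[:2:] dvd a ^ 2 - expand_sq a"
proof (induction a rule: pCons_induct)
  case 0
  then show ?case by (simp add: expand_sq_def)
next
  case (pCons c a)
  have "2 dvd c ^ 2 - c" by simp
  then obtain d where d: "c ^ 2 - c = 2 * d" by (elim dvdE)
  obtain e where e: "a ^ 2 - expand_sq a = [:2:] * e" using pCons.IH by (elim dvdE)
  let ?X = "[:0, 1:] :: int poly"
  have x: "pCons c a = [:c:] + ?X * a" by simp
  have y: "expand_sq (pCons c a) = [:c:] + ?X ^ 2 * expand_sq a"
    by (simp add: expand_sq_def pcompose_pCons power2_eq_square)
  have "pCons c a ^ 2 - expand_sq (pCons c a)
      = ([:c:] ^ 2 - [:c:]) + [:2:] * ([:c:] * ?X * a) + ?X ^ 2 * (a ^ 2 - expand_sq a)"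
    unfolding y unfolding x by (simp add: power2_eq_square algebra_simps numeral_poly)
  also have "[:c:] ^ 2 - [:c:] = [:2:] * [:d:]"
    using d by (simp add: power2_eq_square)
  also have "[:2:] * [:d:] + [:2:] * ([:c:] * ?X * a) + ?X ^ 2 * (a ^ 2 - expand_sq a)
      = [:2:] * ([:d:] + [:c:] * ?X * a + ?X ^ 2 * e)"
    unfolding e by (simp only: algebra_simps)
  finally show ?case by (metis dvd_triv_left)
qed

lemma const_poly_power_Suc: "[:2 ^ Suc m:] * u = [:2:] * ([:2 ^ m:] * u)" for u :: "int poly"
  by (simp add: mult.commute)

lemma low_polys_divide:
  assumes "[:n:] * c \<in> low_polys r" "n \<noteq> 0"
  shows "c \<in> low_polys r"
  using assms by (simp add: low_polys_def)

lemma finite_binary_low_polys: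
  "finite {a \<in> low_polys r. \<forall>i. Polynomial.coeff a i \<in> {0, 1}}"
proof (rule finite_subset)
  show "{a \<in> low_polys r. \<forall>i. Polynomial.coeff a i \<in> {0, 1}}
      \<subseteq> Poly ` {xs. set xs \<subseteq> {0, 1} \<and> length xs = r}"
  proof
    fix a assume a: "a \<in> {a \<in> low_polys r. \<forall>i. Polynomial.coeff a i \<in> {0, 1}}"
    have "a = Poly (map (Polynomial.coeff a) [0..<r])"
      using a by (auto simp: poly_eq_iff low_polys_def nth_default_def)
    moreover have "length (map (Polynomial.coeff a) [0..<r]) = r" by simp
    moreover have "set (map (Polynomial.coeff a) [0..<r]) \<subseteq> {0, 1}"
      using a by (simp add: image_subset_iff)
    ultimately show "a \<in> Poly ` {xs. set xs \<subseteq> {0, 1} \<and> length xs = r}"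
      by blast
  qed
  show "finite (Poly ` {xs. set xs \<subseteq> {0, 1 :: int} \<and> length xs = r})"
    by (intro finite_imageI finite_lists_length_eq) simp
qed

context
  fixes f :: "int poly" and r :: nat
  assumes monic: "Polynomial.lead_coeff f = 1"
    and deg: "Polynomial.degree f = r"
    and irr: "Factorial_Ring.irreducible (poly_mod2 f)"
begin

text \<open>The reduction of \<open>f\<close> is irreducible, hence prime, so the residue ring
  modulo \<open>2\<close> and \<open>f\<close> has no nonzero nilpotents.\<close>

lemma square_in_galois_ideal_2:
  assumes "c ^ 2 \<in> galois_ideal 2 f"
  shows "c \<in> galois_ideal 2 f"
proof -
  obtain u v where uv: "c ^ 2 = [:2:] * u + f * v" using assms by (rule galois_idealE)
  have "[:2:] dvd c ^ 2 - f * v" unfolding uv by (metis add_diff_cancel_right' dvd_triv_left)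
  then have "poly_mod2 c * poly_mod2 c = poly_mod2 f * poly_mod2 v"
    by (metis poly_mod2_eq_iff poly_mod2_hom(3) power2_eq_square)
  then have "poly_mod2 f dvd poly_mod2 c * poly_mod2 c" by simp
  then have "poly_mod2 f dvd poly_mod2 c"
    using field_poly_irreducible_imp_prime[OF irr] prime_elem_dvd_mult_iff by blast
  then obtain w where "poly_mod2 c = poly_mod2 (f * w)"
    by (metis dvdE surj_poly_mod2 poly_mod2_hom(3))
  then obtain e where "c - f * w = [:2:] * e" unfolding poly_mod2_eq_iff by (elim dvdE)
  then have "c = [:2:] * e + f * w" by (simp only: algebra_simps)
  then show ?thesis by (rule galois_idealI)
qed

text \<open>Injectivity of Frobenius on the residue field, since \<open>expand_sq c\<close> is
  congruent to \<open>c\<^sup>2\<close>.\<close>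

lemma expand_sq_in_galois_ideal_2:
  assumes "c \<in> low_polys r" "expand_sq c \<in> galois_ideal 2 f"
  shows "[:2:] dvd c"
proof -
  have "c ^ 2 - expand_sq c \<in> galois_ideal 2 f"
    by (rule dvd_imp_galois_ideal[OF square_cong_expand_sq])
  from galois_ideal_closed(1)[OF this assms(2)] have "c ^ 2 \<in> galois_ideal 2 f" by simp
  then show ?thesis
    using assms(1) deg galois_ideal_low_dvd[OF monic] square_in_galois_ideal_2 by blast
qed

text \<open>Injectivity lifts from modulo \<open>2\<close> to modulo \<open>2 ^ m\<close> by
  halving: \<open>c\<close> is even by the residue field case, then \<open>f * v\<close> and hence
  \<open>v\<close> is even, and the whole relation can be divided by \<open>2\<close>.\<close>

lemma expand_sq_in_galois_ideal:
  assumes "c \<in> low_polys r" "expand_sq c \<in> galois_ideal (2 ^ m) f"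
  shows "[:2 ^ m:] dvd c"
  using assms
proof (induction m arbitrary: c)
  case 0
  then show ?case by (simp flip: one_pCons)
next
  case (Suc m)
  obtain u v where uv: "expand_sq c = [:2 ^ Suc m:] * u + f * v"
    using Suc.prems(2) by (rule galois_idealE)
  then have "expand_sq c \<in> galois_ideal 2 f"
    unfolding const_poly_power_Suc by (rule galois_idealI)
  then have "[:2:] dvd c" using expand_sq_in_galois_ideal_2 Suc.prems(1) by blast
  then obtain d where d: "c = [:2:] * d" by (elim dvdE)
  have "f * v = [:2:] * (expand_sq d - [:2 ^ m:] * u)"
    using uv unfolding d expand_sq_smult const_poly_power_Suc by (simp only: algebra_simps)
  then have "[:2:] dvd f * v" by (rule dvdI)
  then have "[:2:] dvd v"
    by (rule prime_dvd_monic_mult[OF monic two_is_prime])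
  then obtain w where w: "v = [:2:] * w" by (elim dvdE)
  have "[:2:] * expand_sq d = [:2:] * ([:2 ^ m:] * u + f * w)"
    using uv unfolding d w expand_sq_smult const_poly_power_Suc by (simp only: algebra_simps)
  then have "expand_sq d = [:2 ^ m:] * u + f * w"
    by (subst (asm) mult_cancel_left) simp
  then have "expand_sq d \<in> galois_ideal (2 ^ m) f" by (rule galois_idealI)
  moreover have "d \<in> low_polys r"
    using Suc.prems(1) d low_polys_divide[of 2 d] by simp
  ultimately have "[:2 ^ m:] dvd d" by (intro Suc.IH)
  then obtain e where "d = [:2 ^ m:] * e" by (elim dvdE)
  then have "c = [:2 ^ Suc m:] * e" unfolding d const_poly_power_Suc by simp
  then show ?case by (rule dvdI)
qed

lemma binary_representative:
  "\<exists>a \<in> low_polys r. (\<forall>i. Polynomial.coeff a i \<in> {0, 1}) \<and> t - a \<in> galois_ideal 2 f"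
proof -
  obtain q c where qc: "t = f * q + c" "c \<in> low_polys r"
    using monic_division[OF monic] deg by metis
  obtain a where a: "poly_mod2 c = poly_mod2 a" "\<And>i. Polynomial.coeff a i \<in> {0, 1}"
    using surj_poly_mod2 by metis
  \<comment> \<open>Lifting does not raise the degree: beyond \<open>r\<close> the coefficient of
    \<open>a\<close> is even and lies in \<open>{0, 1}\<close>.\<close>
  have "Polynomial.coeff a i = 0" if "i \<ge> r" for i
  proof -
    have "(of_int (Polynomial.coeff a i) :: bit) = of_int (Polynomial.coeff c i)"
      using a(1) coeff_poly_mod2 by metis
    then show ?thesis using qc(2) that a(2)[of i] by (auto simp: low_polys_def)
  qed
  then have "a \<in> low_polys r" by (simp add: low_polys_def)
  moreover obtain e where "c - a = [:2:] * e" using a(1) unfolding poly_mod2_eq_iff by (elim dvdE)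
  then have "t - a = [:2:] * e + f * q" using qc(1) by (simp only: algebra_simps)
  then have "t - a \<in> galois_ideal 2 f" by (rule galois_idealI)
  ultimately show ?thesis using a(2) by blast
qed

text \<open>Squaring is an injective self-map of a finite set of representatives modulo
  \<open>(2, f)\<close>, hence surjective.\<close>
lemma expand_sq_surj_2: "\<exists>c \<in> low_polys r. t - expand_sq c \<in> galois_ideal 2 f"
proof -
  define V where "V = {a \<in> low_polys r. \<forall>i. Polynomial.coeff a i \<in> {0, 1}}"
  have "\<forall>t. \<exists>a. a \<in> V \<and> t - a \<in> galois_ideal 2 f"
    using binary_representative by (auto simp: V_def)
  \<comment> \<open>\<open>N\<close> chooses a representative in \<open>V\<close>, so that
    \<open>N \<circ> expand_sq\<close> is Frobenius as a self-map of \<open>V\<close>.\<close>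
  then obtain N where N: "\<And>t. N t \<in> V" "\<And>t. t - N t \<in> galois_ideal 2 f"
    using choice by metis
  have cong: "s - t \<in> galois_ideal 2 f" if "N s = N t" for s t
    using galois_ideal_closed(2)[OF N(2)[of s] N(2)[of t]] that by simp
  have "inj_on (N \<circ> expand_sq) V"
  proof (rule inj_onI)
    fix a b assume ab: "a \<in> V" "b \<in> V" "(N \<circ> expand_sq) a = (N \<circ> expand_sq) b"
    have "expand_sq (a - b) \<in> galois_ideal 2 f"
      using cong ab(3) by (simp add: expand_sq_diff)
    moreover have "a - b \<in> low_polys r" using ab by (auto simp: V_def)
    ultimately have "[:2:] dvd a - b" using expand_sq_in_galois_ideal_2 by blast
    then have "2 dvd Polynomial.coeff a i - Polynomial.coeff b i" for i
      by (simp add: const_poly_dvd_iff)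
    moreover have "Polynomial.coeff a i \<in> {0, 1}" "Polynomial.coeff b i \<in> {0, 1}" for i
      using ab by (auto simp: V_def)
    ultimately show "a = b"
      unfolding poly_eq_iff by (metis (no_types, lifting) insertE singletonD diff_0_right
          diff_0 dvd_minus_iff odd_one)
  qed
  moreover have "finite V" "(N \<circ> expand_sq) ` V \<subseteq> V"
    using finite_binary_low_polys N(1) by (auto simp: V_def)
  ultimately have "(N \<circ> expand_sq) ` V = V" using endo_inj_surj by blast
  then obtain c where "c \<in> V" "N t = N (expand_sq c)" using N(1)[of t] by (metis imageE comp_apply)
  then show ?thesis using cong by (auto simp: V_def)
qed

text \<open>Successive approximation: the error \<open>2 ^ m * u\<close> is corrected by adding
  \<open>2 ^ m * d\<close> to \<open>c\<close>, where \<open>d\<close> solves the problem for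
  \<open>u\<close> modulo \<open>2\<close>.\<close>

lemma expand_sq_surj: "\<exists>c \<in> low_polys r. t - expand_sq c \<in> galois_ideal (2 ^ m) f"
proof (induction m)
  case 0
  show ?case
    by (rule bexI[of _ 0]) (auto intro!: dvd_imp_galois_ideal simp flip: one_pCons)
next
  case (Suc m)
  then obtain c u v where c: "c \<in> low_polys r" "t - expand_sq c = [:2 ^ m:] * u + f * v"
    by (metis galois_idealE)
  obtain d u' v' where d: "d \<in> low_polys r" "u - expand_sq d = [:2:] * u' + f * v'"
    using expand_sq_surj_2 by (metis galois_idealE)
  have "t - expand_sq (c + [:2 ^ m:] * d) = [:2 ^ m:] * (u - expand_sq d) + f * v"
    using c(2) unfolding expand_sq_add expand_sq_smult by (simp only: algebra_simps)
  also have "\<dots> = [:2 ^ Suc m:] * u' + f * (v + [:2 ^ m:] * v')"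
    unfolding d(2) const_poly_power_Suc by (simp only: algebra_simps)
  finally have "t - expand_sq (c + [:2 ^ m:] * d) \<in> galois_ideal (2 ^ Suc m) f"
    by (rule galois_idealI)
  moreover have "c + [:2 ^ m:] * d \<in> low_polys r"
    using low_polys_closed(1)[OF c(1) low_polys_smult[OF d(1)]] by simp
  ultimately show ?case by blast
qed

end

section \<open>The star group for odd \<open>p\<close> and for \<open>p = 2\<close>\<close>

lemma star_group_galois_class:
  fixes f :: "int poly" and p k :: nat
  defines "R \<equiv> galois_ring p k f" and "Q \<equiv> galois_class p k f"
  shows "(Q x, Q y) \<in> carrier (star_group R)"
    "(Q x, Q y) \<otimes>\<^bsub>star_group R\<^esub> (Q x', Q y') = (Q (x + x'), Q (y + y' + x * x'))"
    "(Q x, Q y) = \<one>\<^bsub>star_group R\<^esub> \<longleftrightarrow>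
      x \<in> galois_ideal (int p ^ k) f \<and> y \<in> galois_ideal (int p ^ k) f"
  unfolding R_def Q_def
  by (simp_all add: star_group_def galois_class_simps galois_class_eq_zero_iff)

lemma group_star_galois_ring: "Group.group (star_group (galois_ring p k f))"
  by (rule comm_group.axioms(2)[OF star_group_comm_group[OF galois_ring_cring]])

lemma star_group_odd:
  fixes f :: "int poly"
  assumes p: "odd p" and monic: "Polynomial.lead_coeff f = 1" and deg: "Polynomial.degree f = r"
  shows "star_group (galois_ring p k f) \<cong> cyclic_power (p ^ k) r \<times>\<times> cyclic_power (p ^ k) r"
proof -
  define n where "n = int p ^ k"
  \<comment> \<open>As \<open>n\<close> is odd, \<open>h\<close> is an inverse of \<open>2\<close>
    modulo \<open>n\<close>; below, \<open>h * a\<^sup>2\<close> stands for half of the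
    square.\<close>
  define h where "h = (n + 1) div 2"
  have "odd n" using p by (simp add: n_def)
  then have h: "2 * h = n + 1" by (auto simp: h_def elim!: oddE)
  then have h_poly: "2 * [:h:] = [:n:] + 1" by (simp add: numeral_poly one_pCons mult.commute)
  let ?Q = "galois_class p k f" and ?I = "galois_ideal n f"
  let ?S = "star_group (galois_ring p k f)"
  \<comment> \<open>The inverse of the straightening map, precomposed with passage to residue
    classes.\<close>
  define g where "g = (\<lambda>(a, b). (?Q a, ?Q ([:h:] * a ^ 2 + b)))"
  have hom: "g \<in> hom (low_poly_pairs r) ?S"
  proof (rule homI)
    fix w z :: "int poly \<times> int poly"
    show "g w \<in> carrier ?S"
      by (simp add: g_def star_group_galois_class split: prod.split)
    obtain a b a' b' where wz: "w = (a, b)" "z = (a', b')" by fastforce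
    have "[:h:] * (a + a') ^ 2 + (b + b')
        - (([:h:] * a ^ 2 + b) + ([:h:] * a' ^ 2 + b') + a * a') = (2 * [:h:] - 1) * (a * a')"
      by (simp add: power2_eq_square algebra_simps)
    also have "\<dots> = [:n:] * (a * a') + f * 0" unfolding h_poly by simp
    finally have "?Q ([:h:] * (a + a') ^ 2 + (b + b'))
        = ?Q (([:h:] * a ^ 2 + b) + ([:h:] * a' ^ 2 + b') + a * a')"
      unfolding galois_class_eq_iff n_def[symmetric] by (rule galois_idealI)
    then show "g (w \<otimes>\<^bsub>low_poly_pairs r\<^esub> z) = g w \<otimes>\<^bsub>?S\<^esub> g z"
      unfolding wz by (simp add: g_def low_poly_pairs_def star_group_galois_class)
  qed
  have surj: "carrier ?S \<subseteq> g ` (low_polys r \<times> low_polys r)"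
  proof
    fix w assume "w \<in> carrier ?S"
    then obtain x y where w: "w = (?Q x, ?Q y)"
      by (auto simp: star_group_def elim!: galois_class_surj)
    obtain q a where a: "x = f * q + a" "a \<in> low_polys r"
      using monic_division[OF monic] deg by metis
    obtain q' b where b: "y - [:h:] * a ^ 2 = f * q' + b" "b \<in> low_polys r"
      using monic_division[OF monic] deg by metis
    have "x - a = [:n:] * 0 + f * q" using a(1) by simp
    then have "x - a \<in> ?I" by (rule galois_idealI)
    moreover have "y - ([:h:] * a ^ 2 + b) = [:n:] * 0 + f * q'"
      using b(1) by (simp add: algebra_simps)
    then have "y - ([:h:] * a ^ 2 + b) \<in> ?I" by (rule galois_idealI)
    ultimately have "w = g (a, b)"
      using w by (simp add: g_def galois_class_eq_iff n_def)
    then show "w \<in> g ` (low_polys r \<times> low_polys r)" using a(2) b(2) by blast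
  qed
  have ker: "g (a, b) = \<one>\<^bsub>?S\<^esub> \<longleftrightarrow> [:int (p ^ k):] dvd a \<and> [:int (p ^ k):] dvd b"
    if ab: "a \<in> low_polys r" "b \<in> low_polys r" for a b
  proof -
    have low_iff: "c \<in> ?I \<longleftrightarrow> [:n:] dvd c" if "c \<in> low_polys r" for c
      using that galois_ideal_low_dvd[OF monic] dvd_imp_galois_ideal deg by blast
    have "g (a, b) = \<one>\<^bsub>?S\<^esub> \<longleftrightarrow> a \<in> ?I \<and> [:h:] * a ^ 2 + b \<in> ?I"
      by (simp only: g_def prod.case star_group_galois_class n_def)
    also have "\<dots> \<longleftrightarrow> a \<in> ?I \<and> b \<in> ?I"
    proof (rule conj_cong[OF refl])
      assume "a \<in> ?I"
      then have *: "[:h:] * a ^ 2 \<in> ?I"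
        using galois_ideal_closed(3)[of a n f "[:h:] * a"]
        by (simp only: power2_eq_square mult.assoc)
      show "[:h:] * a ^ 2 + b \<in> ?I \<longleftrightarrow> b \<in> ?I"
        using galois_ideal_closed(1)[OF *, of b] galois_ideal_closed(2)[OF _ *] by fastforce
    qed
    finally show ?thesis using low_iff ab by (simp add: n_def)
  qed
  have "p ^ k > 0" using p by (simp add: odd_pos)
  from iso_cyclic_powers[OF this this group_star_galois_ring hom surj ker] show ?thesis .
qed

lemma star_group_even:
  fixes f :: "int poly"
  assumes k: "k \<ge> 1" and monic: "Polynomial.lead_coeff f = 1" and deg: "Polynomial.degree f = r"
    and irr: "Factorial_Ring.irreducible (poly_mod2 f)"
  shows "star_group (galois_ring 2 k f) \<cong>
    cyclic_power (2 ^ (k + 1)) r \<times>\<times> cyclic_power (2 ^ (k - 1)) r"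
proof -
  obtain l where l: "k = Suc l" using k by (cases k) auto
  define n :: int where "n = 2 ^ k"
  have n2: "2 * n = 2 ^ Suc k" "n = 2 * 2 ^ l" by (simp_all add: n_def l)
  let ?Q = "galois_class 2 k f" and ?I = "galois_ideal n f"
  let ?S = "star_group (galois_ring 2 k f)"
  txt \<open>The formula for \<open>y\<close> makes \<open>x\<^sup>2 - 2 y\<close> equal to \<open>s\<close>, which is additive in the pair; division by \<open>2\<close> is exact.\<close>
  define x where "x = (\<lambda>(a, b). a + [:2:] * b :: int poly)"
  define s where "s = (\<lambda>(a, b). expand_sq (a + [:4:] * b))"
  define y where "y = (\<lambda>w. (x w ^ 2 - s w) div [:2:])"
  have y: "[:2:] * y w = x w ^ 2 - s w" for w
  proof -
    obtain a b where w: "w = (a, b)" by fastforce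
    have four: "[:4:] * c = [:2:] * c + [:2:] * c" for c :: "int poly"
      by (simp flip: smult_add_left)
    \<comment> \<open>Because \<open>a + 4 b = (a + 2 b) + 2 b\<close>, \<open>s\<close> differs
      from \<open>expand_sq\<close> of \<open>x\<close> by an even polynomial, and the latter is
      congruent to the square of \<open>x\<close> modulo \<open>2\<close>.\<close>
    have "s w = expand_sq (x w) + [:2:] * expand_sq b"
      unfolding w s_def x_def prod.case expand_sq_add expand_sq_smult four add.assoc ..
    then have "x w ^ 2 - s w = (x w ^ 2 - expand_sq (x w)) - [:2:] * expand_sq b"
      by (simp only: algebra_simps)
    then have "[:2:] dvd x w ^ 2 - s w"
      by (metis dvd_diff square_cong_expand_sq dvd_triv_left)
    then show ?thesis unfolding y_def by (rule dvd_mult_div_cancel)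
  qed
  define g where "g = (\<lambda>w. (?Q (x w), ?Q (y w)))"
  have Q_eq: "?Q a = ?Q b \<longleftrightarrow> a - b \<in> ?I" for a b by (simp add: galois_class_eq_iff n_def)
  \<comment> \<open>Halving is done on integer polynomials, where \<open>2\<close> is not a zero
    divisor, unlike in the Galois ring.\<close>
  have cancel: "a = b" if "[:2:] * a = [:2:] * b" for a b :: "int poly"
    using that by (subst (asm) mult_cancel_left) simp
  have hom: "g \<in> hom (low_poly_pairs r) ?S"
  proof (rule homI)
    fix w z
    show "g w \<in> carrier ?S" by (simp add: g_def star_group_galois_class)
    have x_add: "x (w + z) = x w + x z" and s_add: "s (w + z) = s w + s z"
      by (cases w; cases z; simp add: x_def s_def expand_sq_add smult_add_right)+
    have "[:2:] * y (w + z) = [:2:] * (y w + y z + x w * x z)"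
    proof -
      have "[:2:] * (y w + y z + x w * x z) = [:2:] * y w + [:2:] * y z + [:2:] * (x w * x z)"
        by (simp only: distrib_left)
      also have "\<dots> = [:2:] * y (w + z)"
        unfolding y x_add s_add by (simp add: power2_eq_square algebra_simps numeral_poly)
      finally show ?thesis ..
    qed
    then have "y (w + z) = y w + y z + x w * x z" by (rule cancel)
    then show "g (w \<otimes>\<^bsub>low_poly_pairs r\<^esub> z) = g w \<otimes>\<^bsub>?S\<^esub> g z"
      using x_add by (simp add: g_def low_poly_pairs_def star_group_galois_class)
  qed
  have surj: "carrier ?S \<subseteq> g ` (low_polys r \<times> low_polys r)"
  proof
    fix w assume "w \<in> carrier ?S"
    then obtain x' y' where w: "w = (?Q x', ?Q y')"
      by (auto simp: star_group_def elim!: galois_class_surj)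
    obtain q x0 where x0: "x' = f * q + x0" "x0 \<in> low_polys r"
      using monic_division[OF monic] deg by metis
    \<comment> \<open>The target value of \<open>s\<close> is \<open>x0\<^sup>2 - 2 y'\<close>. It
      is matched modulo \<open>2 ^ (k + 1)\<close> because one factor \<open>2\<close> is lost when
      solving for \<open>y\<close>.\<close>
    obtain c where c: "c \<in> low_polys r"
      "x0 ^ 2 - [:2:] * y' - expand_sq c \<in> galois_ideal (2 ^ Suc k) f"
      using expand_sq_surj[OF monic deg irr] by blast
    obtain u v where uv: "x0 ^ 2 - [:2:] * y' - expand_sq c = [:2 ^ Suc k:] * u + f * v"
      using c(2) by (rule galois_idealE)
    obtain e where e: "x0 ^ 2 - expand_sq x0 = [:2:] * e"
      using square_cong_expand_sq by (rule dvdE)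
    \<comment> \<open>Modulo \<open>2\<close> and \<open>f\<close>, \<open>expand_sq c\<close> and
      \<open>expand_sq x0\<close> both agree with \<open>x0\<^sup>2\<close>, so \<open>c\<close> and
      \<open>x0\<close> are congruent modulo \<open>2\<close>. The system
      \<open>a + 2 b = x0\<close>, \<open>a + 4 b = c\<close> is then solvable.\<close>
    have "expand_sq (c - x0) = [:2:] * (e - y' - [:2 ^ k:] * u) + f * (- v)"
      using uv e unfolding expand_sq_diff const_poly_power_Suc by (simp only: algebra_simps)
    then have "expand_sq (c - x0) \<in> galois_ideal 2 f" by (rule galois_idealI)
    moreover have "c - x0 \<in> low_polys r" using c(1) x0(2) by blast
    ultimately have "[:2:] dvd c - x0" using expand_sq_in_galois_ideal_2[OF monic deg irr] by blast
    then obtain b where b: "c - x0 = [:2:] * b" by (elim dvdE)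
    have b_low: "b \<in> low_polys r" using \<open>c - x0 \<in> low_polys r\<close> b low_polys_divide[of 2 b] by simp
    define a where "a = x0 - [:2:] * b"
    have a_low: "a \<in> low_polys r"
      using low_polys_closed(2)[OF x0(2) low_polys_smult[OF b_low, of 2]] by (simp add: a_def)
    have x_ab: "x (a, b) = x0" by (simp add: x_def a_def)
    have "a + [:4:] * b = x0 + [:2:] * b" by (simp add: a_def algebra_simps flip: smult_add_left)
    also have "\<dots> = c" using b by (simp only: algebra_simps)
    finally have s_ab: "s (a, b) = expand_sq c" by (simp add: s_def)
    have y2: "[:2:] * y (a, b) = [:2:] * (y' + [:2 ^ k:] * u) + f * v"
      using uv unfolding y x_ab s_ab const_poly_power_Suc by (simp only: algebra_simps)
    \<comment> \<open>The cofactor of \<open>f\<close> must be even before the relation for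
      \<open>y (a, b)\<close> can be halved.\<close>
    have "f * v = [:2:] * (y (a, b) - y' - [:2 ^ k:] * u)"
      using y2 by (simp only: algebra_simps)
    then have "[:2:] dvd f * v" by (rule dvdI)
    then have "[:2:] dvd v"
    by (rule prime_dvd_monic_mult[OF monic two_is_prime])
    then obtain v' where v': "v = [:2:] * v'" by (elim dvdE)
    have "[:2:] * (y' - y (a, b)) = [:2:] * ([:n:] * (- u) + f * (- v'))"
      using y2 unfolding v' n_def by (simp only: algebra_simps)
    then have "y' - y (a, b) = [:n:] * (- u) + f * (- v')" by (rule cancel)
    then have "y' - y (a, b) \<in> ?I" by (rule galois_idealI)
    moreover have "x' - x0 = [:n:] * 0 + f * q" using x0(1) by simp
    then have "x' - x0 \<in> ?I" by (rule galois_idealI)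
    ultimately have "w = g (a, b)" using w by (simp add: g_def Q_eq x_ab)
    then show "w \<in> g ` (low_polys r \<times> low_polys r)" using a_low b_low by blast
  qed
  have ker: "g (a, b) = \<one>\<^bsub>?S\<^esub> \<longleftrightarrow> [:int (2 ^ (k + 1)):] dvd a \<and> [:int (2 ^ (k - 1)):] dvd b"
    if ab: "a \<in> low_polys r" "b \<in> low_polys r" for a b
  proof -
    have "g (a, b) = \<one>\<^bsub>?S\<^esub> \<longleftrightarrow> x (a, b) \<in> ?I \<and> y (a, b) \<in> ?I"
      by (simp add: g_def star_group_galois_class n_def)
    also have "\<dots> \<longleftrightarrow> [:2 * n:] dvd a \<and> [:2 ^ l:] dvd b"
    proof
      assume I: "x (a, b) \<in> ?I \<and> y (a, b) \<in> ?I"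
      have low: "a + [:t:] * b \<in> low_polys r" for t
        using low_polys_closed(1)[OF ab(1) low_polys_smult[OF ab(2)]] by simp
      then have "[:n:] dvd x (a, b)"
        using I galois_ideal_low_dvd[OF monic, of "x (a, b)"] deg by (simp only: x_def prod.case)
      then obtain u where u: "x (a, b) = [:n:] * u" by (elim dvdE)
      obtain u' v' where uv: "y (a, b) = [:n:] * u' + f * v'" using I by (auto elim: galois_idealE)
      \<comment> \<open>Since \<open>k\<close> is positive, \<open>n\<^sup>2\<close> is a multiple
        of \<open>2 n\<close>. So the square of \<open>x\<close> vanishes modulo \<open>2 n\<close>,
        and with it \<open>s\<close>.\<close>
      have nn: "[:n:] * [:n:] = [:2 * n:] * [:2 ^ l:]" using n2(2) by simp
      have n2p: "[:2 * n:] = [:2:] * [:n:]" by simp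
      have "s (a, b) = x (a, b) ^ 2 - [:2:] * y (a, b)" using y[of "(a, b)"] by simp
      also have "\<dots> = ([:n:] * [:n:]) * u ^ 2 - [:2:] * ([:n:] * u' + f * v')"
        unfolding u uv by (simp only: power2_eq_square mult.assoc mult.left_commute)
      also have "\<dots> = [:2 * n:] * ([:2 ^ l:] * u ^ 2 - u') + f * ([:2:] * - v')"
        unfolding nn unfolding n2p by (simp only: algebra_simps)
      finally have "s (a, b) \<in> galois_ideal (2 ^ Suc k) f"
        unfolding n2(1)[symmetric] by (rule galois_idealI)
      then have c: "[:2 * n:] dvd a + [:4:] * b"
        unfolding s_def prod.case n2(1) by (rule expand_sq_in_galois_ideal[OF monic deg irr low])
      have "2 ^ l dvd Polynomial.coeff b i \<and> 2 * n dvd Polynomial.coeff a i" for i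
      proof -
        define A B where "A = Polynomial.coeff a i" and "B = Polynomial.coeff b i"
        have 1: "n dvd A + 2 * B"
          using \<open>[:n:] dvd x (a, b)\<close> by (simp add: x_def const_poly_dvd_iff A_def B_def)
        have 2: "2 * n dvd A + 4 * B" using c by (simp add: const_poly_dvd_iff A_def B_def)
        then have "n dvd A + 4 * B" by (rule dvd_mult_right)
        \<comment> \<open>Subtracting isolates \<open>2 B\<close>. As \<open>n = 2 * 2 ^ l\<close>,
          this gives \<open>2 ^ l\<close> dividing \<open>B\<close>; then \<open>4 B\<close> is a
          multiple of \<open>2 n\<close>, and so is \<open>A\<close>.\<close>
        then have "n dvd (A + 4 * B) - (A + 2 * B)" using 1 by (rule dvd_diff)
        then have "2 * 2 ^ l dvd 2 * B" using n2(2) by simp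
        then have B: "2 ^ l dvd B" by simp
        then have "2 * n dvd 4 * B" using n2(2) by simp
        then have "2 * n dvd A" using 2 by (metis dvd_add_left_iff)
        then show ?thesis using B by (simp add: A_def B_def)
      qed
      then show "[:2 * n:] dvd a \<and> [:2 ^ l:] dvd b" by (simp add: const_poly_dvd_iff)
    next
      assume "[:2 * n:] dvd a \<and> [:2 ^ l:] dvd b"
      then obtain a' b' where a': "a = [:2 * n:] * a'" and b': "b = [:2 ^ l:] * b'"
        by (elim conjE dvdE)
      have x_ab: "x (a, b) = [:n:] * ([:2:] * a' + b')"
        unfolding x_def prod.case a' b' using n2(2) by (simp add: smult_add_right mult.commute)
      have "a + [:4:] * b = [:2 * n:] * (a' + b')"
        unfolding a' b' using n2(2) by (simp add: smult_add_right mult.commute)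
      then have s_ab: "s (a, b) = [:2:] * ([:n:] * expand_sq (a' + b'))"
        by (simp only: s_def prod.case expand_sq_smult) (simp add: mult.commute)
      have "x (a, b) ^ 2 = [:2:] * ([:n:] * ([:2 ^ l:] * ([:2:] * a' + b') ^ 2))"
        unfolding x_ab power_mult_distrib using n2(2) by (simp add: power2_eq_square mult.commute)
      then have "[:2:] * y (a, b) =
          [:2:] * ([:n:] * ([:2 ^ l:] * ([:2:] * a' + b') ^ 2 - expand_sq (a' + b')))"
        unfolding y s_ab by (simp only: algebra_simps)
      then have "y (a, b) = [:n:] * ([:2 ^ l:] * ([:2:] * a' + b') ^ 2 - expand_sq (a' + b'))"
        by (rule cancel)
      then have "[:n:] dvd y (a, b)" by (rule dvdI)
      moreover have "[:n:] dvd x (a, b)" using x_ab by (rule dvdI)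
      ultimately show "x (a, b) \<in> ?I \<and> y (a, b) \<in> ?I" by (blast intro: dvd_imp_galois_ideal)
    qed
    finally show ?thesis by (simp add: n2(1) l n_def)
  qed
  show ?thesis
    by (rule iso_cyclic_powers[OF _ _ group_star_galois_ring hom surj ker]) simp_all
qed

theorem theorem5p5:
  fixes p k r :: nat and f :: "int poly"
  assumes "Factorial_Ring.prime p" and "k \<ge> 1" and "r \<ge> 1"
    and "Polynomial.lead_coeff f = 1" and "Polynomial.degree f = r"
    and "ring_irreducible\<^bsub>UP (residue_ring (int p))\<^esub> (reduce_poly p f)"
  shows "(p \<ge> 3 \<longrightarrow>
           star_group (galois_ring p k f) \<cong> cyclic_power (p ^ k) r \<times>\<times> cyclic_power (p ^ k) r) \<and>
         (p = 2 \<longrightarrow>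
           star_group (galois_ring p k f) \<cong>
             cyclic_power (2 ^ (k + 1)) r \<times>\<times> cyclic_power (2 ^ (k - 1)) r)"
proof (intro conjI impI)
  assume "p \<ge> 3"
  then have "odd p" using assms(1) prime_odd_nat by simp
  then show "star_group (galois_ring p k f) \<cong> cyclic_power (p ^ k) r \<times>\<times> cyclic_power (p ^ k) r"
    using assms(4,5) by (rule star_group_odd)
next
  assume p: "p = 2"
  then have "Factorial_Ring.irreducible (poly_mod2 f)"
    using assms(6) by (intro irreducible_poly_mod2) simp
  then show "star_group (galois_ring p k f) \<cong>
      cyclic_power (2 ^ (k + 1)) r \<times>\<times> cyclic_power (2 ^ (k - 1)) r"
    unfolding p using assms(2,4,5) by (intro star_group_even)
qed

end
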